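(* Let $q=p^m$ with $p$ an odd prime and $m\in\mathbb{N}$, and let $k\in\mathbb{N}$ with $k\mid q-1$. If $\Gamma(k,q)$ is directed, then it has period $1$, with the only exception of $\Gamma(q-1,q)$, which has period $p$.
   Context: $R_k=\{x^k:x\in\mathbb{F}_q^*\}$; the generalized Paley graph $\Gamma(k,q)$ has vertex set $\mathbb{F}_q$ and an arc $x\to y$ iff $y-x\in R_k$; it is directed iff $R_k\neq-R_k$. The period of a digraph is the greatest common divisor of the lengths of all its directed cycles. *)

theory Defs
  imports
    "HOL-Computational_Algebra.Primes"
    "HOL-Library.Cardinality"
    "Graph_Theory.Arc_Walk"
begin

text \<open>
  The field with \<open>q\<close> elements is a type \<open>'a\<close> of sort \<open>{field, finite}\<close> with \<open>CARD('a) = q\<close>,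
  so \<open>q\<close> is not a separate argument of the graph.
\<close>

definition power_residues :: "nat \<Rightarrow> 'a::{field,finite} set" where
  "power_residues k = {x ^ k | x. x \<noteq> 0}"

definition gen_paley :: "nat \<Rightarrow> ('a::{field,finite}, 'a \<times> 'a) pre_digraph" where
  "gen_paley k =
     \<lparr>verts = UNIV, arcs = {(x, y). y - x \<in> power_residues k}, tail = fst, head = snd\<rparr>"

definition gen_paley_directed :: "'a::{field,finite} itself \<Rightarrow> nat \<Rightarrow> bool" where
  "gen_paley_directed _ k \<longleftrightarrow>
     (power_residues k :: 'a set) \<noteq> uminus ` power_residues k"

text \<open>
  Cycles of \<open>pre_digraph.cycle\<close> are nonempty closed arc walks without repeated vertices.
  A digraph without cycles gets period \<open>0\<close>.
\<close>

definition period :: "('a, 'b) pre_digraph \<Rightarrow> nat" where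
  "period G = Gcd {length c | c. pre_digraph.cycle G c}"

lemma gen_paley_directed_iff_not_symmetric:
  "gen_paley_directed TYPE('a::{field,finite}) k \<longleftrightarrow>
     \<not> symmetric (gen_paley k :: ('a, 'a \<times> 'a) pre_digraph)"
proof -
  let ?R = "power_residues k :: 'a set"
  have ends: "arcs_ends (gen_paley k :: ('a, 'a \<times> 'a) pre_digraph) = {(x, y). y - x \<in> ?R}"
    by (auto simp: arcs_ends_def arc_to_ends_def gen_paley_def)
  have "sym {(x, y). y - x \<in> ?R} \<longleftrightarrow> (\<forall>r\<in>?R. - r \<in> ?R)"
  proof
    assume s: "sym {(x, y). y - x \<in> ?R}"
    show "\<forall>r\<in>?R. - r \<in> ?R"
      using symD[OF s, of 0] by auto
  next
    assume "\<forall>r\<in>?R. - r \<in> ?R"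
    then show "sym {(x, y). y - x \<in> ?R}"
      by (auto intro!: symI)
  qed
  also have "\<dots> \<longleftrightarrow> ?R = uminus ` ?R"
    by (auto simp: image_iff) (metis minus_minus)+
  finally show ?thesis
    by (simp add: gen_paley_directed_def symmetric_def ends)
qed

end

theory Submission
  imports
    Defs
    "HOL-Computational_Algebra.Polynomial"
begin

text \<open>
  A closed walk splits into cycles, so the period divides the length of every closed walk.
  Adding \<open>1\<close> repeatedly gives a closed walk of length \<open>p\<close>.  If \<open>k \<noteq> q - 1\<close>, some \<open>k\<close>-th power
  \<open>g\<close> differs from \<open>1\<close>, and \<open>1 + g + \<dots> + g ^ (q - 2) = (g ^ (q - 1) - 1) / (g - 1) = 0\<close> gives a
  closed walk of length \<open>q - 1\<close>, which is coprime to \<open>p\<close>.  If \<open>k = q - 1\<close>, the only step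
  is \<open>1\<close>, so \<open>p\<close> divides the length of every closed walk.
\<close>

lemma (in wf_digraph) period_dvd_length_closed_walk:
  assumes "awalk u c u"
  shows "period G dvd length c"
  using assms
proof (induction "length c" arbitrary: u c rule: less_induct)
  case less
  show ?case
  \<comment> \<open>The empty walk is not a cycle, but its length 0 is divisible by every
    number.\<close>
  proof (cases "c = [] \<or> distinct (tl (awalk_verts u c))")
    case True
    then have "c = [] \<or> cycle c"
      using less.prems by (auto simp: cycle_def)
    then show ?thesis
      by (auto simp: period_def intro: Gcd_dvd)
  next
    case False
    then obtain e es where c: "c = e # es"
      by (cases c) auto
    with False less.prems have e: "e \<in> arcs G" "tail G e = u"
      and es: "awalk (head G e) es u" "\<not> distinct (awalk_verts (head G e) es)"
      by (auto simp: awalk_Cons_iff)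
    \<comment> \<open>Cutting out the closed walk \<open>r\<close> at the repeated vertex
      \<open>w\<close> leaves a closed walk at \<open>u\<close>. Since the repetition is sought in
      \<open>es\<close>, the arc \<open>e\<close> stays outside \<open>r\<close>, so both walks are
      strictly shorter than \<open>c\<close>.\<close>
    obtain q r s w where qrs: "es = q @ r @ s" "r \<noteq> []"
      "awalk (head G e) q w" "awalk w r w" "awalk w s u"
      using awalk_not_distinct_decomp[OF es] by blast
    have "awalk u (e # q @ s) u"
      using e qrs by (auto simp: awalk_Cons_iff)
    then have "period G dvd length (e # q @ s)"
      using c qrs by (intro less.hyps) auto
    moreover have "period G dvd length r"
      using c qrs by (intro less.hyps) auto
    ultimately have "period G dvd length (e # q @ s) + length r"
      by (rule dvd_add)
    then show ?thesis
      by (simp add: c qrs add_ac)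
  qed
qed

lemma wf_digraph_gen_paley: "wf_digraph (gen_paley k)"
  by unfold_locales (auto simp: gen_paley_def)

lemma awalk_gen_paley_simps:
  "pre_digraph.awalk (gen_paley k) u [] v \<longleftrightarrow> u = v"
  "pre_digraph.awalk (gen_paley k) u (e # c) v \<longleftrightarrow>
     fst e = u \<and> snd e - u \<in> power_residues k \<and> pre_digraph.awalk (gen_paley k) (snd e) c v"
  by (auto simp: pre_digraph.awalk_def pre_digraph.cas.simps gen_paley_def)

text \<open>Arcs depend only on the difference of their ends, so a walk can start anywhere and take
  any prescribed sequence of residues as its steps.\<close>

lemma gen_paley_walk_exists:
  fixes u :: "'a::{field,finite}"
  assumes "set xs \<subseteq> power_residues k"
  shows "\<exists>c. pre_digraph.awalk (gen_paley k) u c (u + sum_list xs) \<and> length c = length xs"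
  using assms
proof (induction xs arbitrary: u)
  case Nil
  then show ?case
    by (simp add: awalk_gen_paley_simps)
next
  case (Cons x xs)
  then obtain c where "pre_digraph.awalk (gen_paley k) (u + x) c (u + x + sum_list xs)"
    "length c = length xs"
    by fastforce
  then show ?case
    using Cons.prems
    by (intro exI[of _ "(u, u + x) # c"]) (simp add: awalk_gen_paley_simps add_ac)
qed

text \<open>The walk from 0 with steps \<open>xs\<close> returns to 0. Each divisibility needed
  below comes from a suitable choice of \<open>xs\<close>.\<close>

lemma period_gen_paley_dvd:
  fixes xs :: "'a::{field,finite} list"
  assumes "set xs \<subseteq> power_residues k" and "sum_list xs = 0"
  shows "period (gen_paley k :: ('a, 'a \<times> 'a) pre_digraph) dvd length xs"
  using gen_paley_walk_exists[OF assms(1), of 0] assms(2)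
    wf_digraph.period_dvd_length_closed_walk[OF wf_digraph_gen_paley]
  by fastforce

lemma one_in_power_residues: "1 \<in> power_residues k"
  by (auto simp: power_residues_def intro: exI[of _ 1])

lemma period_gen_paley_dvd_char:
  "period (gen_paley k :: ('a, 'a \<times> 'a) pre_digraph) dvd CHAR('a::{field,finite})"
  using period_gen_paley_dvd[of "replicate CHAR('a) (1::'a)" k]
  by (simp add: one_in_power_residues sum_list_replicate set_replicate_conv_if)

text \<open>Multiplication by \<open>x\<close> permutes the nonzero elements, so it preserves their
  product, which is nonzero and can be cancelled.\<close>

lemma finite_field_fermat:
  fixes x :: "'a::{field,finite}"
  assumes "x \<noteq> 0"
  shows "x ^ (CARD('a) - 1) = 1"
proof -
  have "(\<Prod>y\<in>UNIV - {0}. x * y) = (\<Prod>y\<in>UNIV - {0}. y)"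
    by (rule prod.reindex_bij_witness[of _ "\<lambda>y. y / x" "\<lambda>y. x * y"]) (use assms in auto)
  then show ?thesis
    by (simp add: prod.distrib)
qed

text \<open>Otherwise \<open>X ^ k - 1\<close> would have all \<open>CARD('a) - 1\<close> nonzero
  elements as roots, more than its degree allows.\<close>

lemma exists_power_neq_one:
  assumes "0 < k" and "k < CARD('a::{field,finite}) - 1"
  shows "\<exists>x::'a. x \<noteq> 0 \<and> x ^ k \<noteq> 1"
proof (rule ccontr)
  assume "\<not> ?thesis"
  then have "UNIV - {0} \<subseteq> {x::'a. poly (monom 1 k - 1) x = 0}"
    by (auto simp: poly_monom)
  then have "card (UNIV - {0::'a}) \<le> card {x::'a. poly (monom 1 k - 1) x = 0}"
    by (intro card_mono) auto
  also have "\<dots> \<le> degree (monom 1 k - 1 :: 'a poly)"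
  proof (rule card_poly_roots_bound)
    \<comment> \<open>As \<open>k\<close> is positive, the constant term does not touch the
      coefficient at \<open>k\<close>.\<close>
    have "coeff (monom 1 k - 1 :: 'a poly) k = 1"
      using assms by (simp add: coeff_1)
    then show "monom 1 k - 1 \<noteq> (0 :: 'a poly)"
      by (metis coeff_0 zero_neq_one)
  qed
  also have "\<dots> \<le> k"
    by (intro degree_diff_le) (auto simp: degree_monom_le)
  finally show False
    using assms by simp
qed

lemma period_gen_paley_dvd_card:
  assumes "0 < k" and "k < CARD('a::{field,finite}) - 1"
  shows "period (gen_paley k :: ('a, 'a \<times> 'a) pre_digraph) dvd CARD('a) - 1"
proof -
  obtain x :: 'a where x: "x \<noteq> 0" "x ^ k \<noteq> 1"
    using exists_power_neq_one[OF assms] by blast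
  define xs where "xs = map (\<lambda>i. (x ^ k) ^ i) [0..<CARD('a) - 1]"
  have "sum_list xs = (\<Sum>i<CARD('a) - 1. (x ^ k) ^ i)"
    unfolding xs_def by (simp add: interv_sum_list_conv_sum_set_nat atLeast0LessThan)
  also have "\<dots> = 0"
    using x finite_field_fermat[of "x ^ k"] by (simp add: geometric_sum)
  finally have "sum_list xs = 0" .
  moreover have "(x ^ k) ^ i \<in> power_residues k" for i
    using x by (auto simp: power_residues_def mult.commute simp flip: power_mult
      intro!: exI[of _ "x ^ i"])
  then have "set xs \<subseteq> power_residues k"
    by (auto simp: xs_def)
  ultimately show ?thesis
    using period_gen_paley_dvd[of xs k] by (simp add: xs_def)
qed

lemma power_residues_card:
  "power_residues (CARD('a) - 1) = {1 :: 'a::{field,finite}}"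
proof
  show "power_residues (CARD('a) - 1) \<subseteq> {1::'a}"
    using finite_field_fermat[where ?'a = 'a] by (auto simp: power_residues_def)
qed (simp add: one_in_power_residues)

text \<open>Every arc adds 1. For a closed walk this makes the length zero in the field, hence a
  multiple of the characteristic.\<close>

lemma gen_paley_card_walk_end:
  fixes u v :: "'a::{field,finite}"
  assumes "pre_digraph.awalk (gen_paley (CARD('a) - 1)) u c v"
  shows "v = u + of_nat (length c)"
  using assms
proof (induction c arbitrary: u)
  case Nil
  then show ?case
    by (simp add: awalk_gen_paley_simps)
next
  case (Cons e c)
  then have "snd e - u = 1" "v = snd e + of_nat (length c)"
    unfolding awalk_gen_paley_simps power_residues_card by auto
  then show ?case
    by (simp add: algebra_simps)
qed

lemma period_gen_paley_card:
  "period (gen_paley (CARD('a) - 1) :: ('a, 'a \<times> 'a) pre_digraph) = CHAR('a::{field,finite})"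
proof (rule dvd_antisym[OF period_gen_paley_dvd_char])
  show "CHAR('a) dvd period (gen_paley (CARD('a) - 1) :: ('a, 'a \<times> 'a) pre_digraph)"
    unfolding period_def
  proof (rule Gcd_greatest, clarify)
    fix c
    assume "pre_digraph.cycle (gen_paley (CARD('a) - 1) :: ('a, 'a \<times> 'a) pre_digraph) c"
    then obtain u :: 'a where "u = u + of_nat (length c)"
      by (auto simp only: pre_digraph.cycle_def dest: gen_paley_card_walk_end)
    then show "CHAR('a) dvd length c"
      by (simp flip: of_nat_eq_0_iff_char_dvd)
  qed
qed

text \<open>Translation by 1 permutes the field and so preserves the sum of all elements. Hence
  \<open>p ^ m\<close> vanishes in the field, and the characteristic is a prime dividing it.\<close>

lemma char_eq_if_card_prime_power:
  assumes "prime p" and "CARD('a::{field,finite}) = p ^ m"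
  shows "CHAR('a) = p"
proof -
  have "prime CHAR('a)"
    using finite_imp_CHAR_pos[where ?'a = 'a] prime_CHAR_semidom[where ?'a = 'a] by simp
  moreover have "(\<Sum>x\<in>UNIV. x + 1) = (\<Sum>x\<in>UNIV. x :: 'a)"
    by (rule sum.reindex_bij_witness[of _ "\<lambda>x. x - 1" "\<lambda>x. x + 1"]) auto
  then have "of_nat (p ^ m) = (0 :: 'a)"
    using assms(2) by (simp add: sum.distrib)
  then have "CHAR('a) dvd p ^ m"
    by (simp only: of_nat_eq_0_iff_char_dvd)
  ultimately show ?thesis
    using assms prime_dvd_power primes_dvd_imp_eq by blast
qed

theorem theorem7p5:
  fixes p m k q :: nat
  assumes "prime p" and "odd p" and "0 < m" and "q = p ^ m"
    and "CARD('a::{field,finite}) = q"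
    and "0 < k" and "k dvd q - 1"
  shows "(gen_paley_directed TYPE('a) k \<and> k \<noteq> q - 1 \<longrightarrow>
            period (gen_paley k :: ('a, 'a \<times> 'a) pre_digraph) = 1) \<and>
         gen_paley_directed TYPE('a) (q - 1) \<and>
         period (gen_paley (q - 1) :: ('a, 'a \<times> 'a) pre_digraph) = p"
proof (intro conjI impI)
  have char: "CHAR('a) = p"
    using assms by (intro char_eq_if_card_prime_power) auto
  have q: "1 < q"
    using assms by (simp add: prime_gt_1_nat one_less_power del: One_nat_def)
  show "period (gen_paley (q - 1) :: ('a, 'a \<times> 'a) pre_digraph) = p"
    using period_gen_paley_card[where ?'a = 'a] assms(5) char by simp
  \<comment> \<open>Oddness of \<open>p\<close> enters here: it gives \<open>1 \<noteq> - 1\<close>,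
    so the residue set \<open>{1}\<close> is not closed under negation.\<close>
  have "of_nat 2 \<noteq> (0 :: 'a)"
    using assms(1,2) primes_dvd_imp_eq[of p 2] two_is_prime_nat
    unfolding of_nat_eq_0_iff_char_dvd char by auto
  then have "(1 :: 'a) \<noteq> - 1"
    by (auto simp: eq_neg_iff_add_eq_0)
  then show "gen_paley_directed TYPE('a) (q - 1)"
    using power_residues_card[where ?'a = 'a] assms(5) by (simp add: gen_paley_directed_def)
  show "period (gen_paley k :: ('a, 'a \<times> 'a) pre_digraph) = 1"
    if "gen_paley_directed TYPE('a) k \<and> k \<noteq> q - 1"
  proof -
    let ?P = "period (gen_paley k :: ('a, 'a \<times> 'a) pre_digraph)"
    have "k < q - 1"
      using that q assms(7) dvd_imp_le[of k "q - 1"] by simp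
    then have "?P dvd q - 1"
      using period_gen_paley_dvd_card[where ?'a = 'a] assms(5,6) by blast
    moreover have "?P dvd q"
      using period_gen_paley_dvd_char[where ?'a = 'a] char assms(3,4) dvd_power
      by (metis dvd_trans)
    \<comment> \<open>The period divides two consecutive numbers, so it divides their difference
      1.\<close>
    ultimately have "?P dvd q - (q - 1)"
      by (rule dvd_diff_nat[rotated])
    then show ?thesis
      using q by simp
  qed
qed

end
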